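(* Let $(T,\eta,\mu)$ be a weakly cartesian monad on a category $\mathsf{C}$. Then for every $T$-algebra $(A,e)$ and every object $S$ of $\mathsf{C}$, the partial evaluation relation on $\mathsf{C}(S,TA)$ is transitive.
   Context: A monad $(T,\eta,\mu)$ on $\mathsf{C}$ has unit $\eta:\mathrm{id}_{\mathsf{C}}\Rightarrow T$ and multiplication $\mu:TT\Rightarrow T$. A $T$-algebra is an object $A$ with a morphism $e:TA\to A$ such that $e\circ\eta_A=\mathrm{id}_A$ and $e\circ Te=e\circ\mu_A$. A commuting square with $f:A'\to B$, $g:A'\to C$, $m:B\to D$, $n:C\to D$, $m\circ f=n\circ g$, is a weak pullback if for every object $S$ and all morphisms $b:S\to B$, $c:S\to C$ with $m\circ b=n\circ c$ there exists a (not necessarily unique) morphism $a:S\to A'$ with $f\circ a=b$ and $g\circ a=c$. The monad $(T,\eta,\mu)$ is weakly cartesian if the functor $T$ preserves weak pullbacks (it sends weak pullback squares to weak pullback squares) and all naturality squares of $\eta$ and of $\mu$ are weak pullbacks. For morphisms $p,q:S\to TA$, a partial evaluation of $p$ into $q$ is a morphism $k:S\to TTA$ such that $\mu_A\circ k=p$ and $(Te)\circ k=q$. The partial evaluation relation on the set $\mathsf{C}(S,TA)$ of morphisms $S\to TA$ relates $p$ to $q$ if and only if there exists a partial evaluation of $p$ into $q$. *)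

theory Defs
  imports Main
begin

record ('o, 'm) cat =
  Obj :: "'o set"
  Arr :: "'m set"
  Dom :: "'m \<Rightarrow> 'o"
  Cod :: "'m \<Rightarrow> 'o"
  Id  :: "'o \<Rightarrow> 'm"
  Comp :: "'m \<Rightarrow> 'm \<Rightarrow> 'm"  (infixl "\<cdot>\<index>" 70)

definition hom :: "('o, 'm) cat \<Rightarrow> 'o \<Rightarrow> 'o \<Rightarrow> 'm set" where
  "hom C A B = {f \<in> Arr C. Dom C f = A \<and> Cod C f = B}"

text \<open>\<open>Dom\<close>, \<open>Cod\<close>, \<open>Id\<close> and \<open>Comp\<close> are unconstrained outside
  \<open>Obj\<close>, \<open>Arr\<close> and composable pairs; every law is relativised accordingly.
  Composition is written in applicative order: \<open>g \<cdot>\<^bsub>C\<^esub> f\<close> is \<open>g\<close> after \<open>f\<close>.\<close>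

locale category =
  fixes C :: "('o, 'm) cat" (structure)
  assumes Dom_in_Obj: "f \<in> Arr C \<Longrightarrow> Dom C f \<in> Obj C"
    and Cod_in_Obj: "f \<in> Arr C \<Longrightarrow> Cod C f \<in> Obj C"
    and Id_in_hom: "A \<in> Obj C \<Longrightarrow> Id C A \<in> hom C A A"
    and Comp_in_hom: "f \<in> hom C X Y \<Longrightarrow> g \<in> hom C Y Z \<Longrightarrow> g \<cdot> f \<in> hom C X Z"
    and Comp_Id: "f \<in> hom C X Y \<Longrightarrow> f \<cdot> Id C X = f"
    and Id_Comp: "f \<in> hom C X Y \<Longrightarrow> Id C Y \<cdot> f = f"
    and Comp_assoc: "f \<in> hom C W X \<Longrightarrow> g \<in> hom C X Y \<Longrightarrow> h \<in> hom C Y Z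
      \<Longrightarrow> (h \<cdot> g) \<cdot> f = h \<cdot> (g \<cdot> f)"

record ('o, 'm, 'p, 'n) functor_data =
  omap :: "'o \<Rightarrow> 'p"
  amap :: "'m \<Rightarrow> 'n"

locale cat_functor = source: category C + target: category D
  for C :: "('o, 'm) cat" and D :: "('p, 'n) cat" +
  fixes F :: "('o, 'm, 'p, 'n) functor_data"
  assumes omap_in_Obj: "A \<in> Obj C \<Longrightarrow> omap F A \<in> Obj D"
    and amap_in_hom: "f \<in> hom C A B \<Longrightarrow> amap F f \<in> hom D (omap F A) (omap F B)"
    and amap_Id: "A \<in> Obj C \<Longrightarrow> amap F (Id C A) = Id D (omap F A)"
    and amap_Comp: "f \<in> hom C X Y \<Longrightarrow> g \<in> hom C Y Z
      \<Longrightarrow> amap F (g \<cdot>\<^bsub>C\<^esub> f) = amap F g \<cdot>\<^bsub>D\<^esub> amap F f"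

definition id_functor :: "('o, 'm, 'o, 'm) functor_data" where
  "id_functor = \<lparr>omap = (\<lambda>A. A), amap = (\<lambda>f. f)\<rparr>"

definition comp_functor ::
  "('p, 'n, 'q, 'k) functor_data \<Rightarrow> ('o, 'm, 'p, 'n) functor_data \<Rightarrow> ('o, 'm, 'q, 'k) functor_data"
  (infixr "\<circ>\<^sub>F" 75) where
  "G \<circ>\<^sub>F F = \<lparr>omap = omap G \<circ> omap F, amap = amap G \<circ> amap F\<rparr>"

locale natural_transformation = dom: cat_functor C D F + cod: cat_functor C D G
  for C :: "('o, 'm) cat" and D :: "('p, 'n) cat"
    and F G :: "('o, 'm, 'p, 'n) functor_data" +
  fixes \<alpha> :: "'o \<Rightarrow> 'n"
  assumes component_in_hom: "A \<in> Obj C \<Longrightarrow> \<alpha> A \<in> hom D (omap F A) (omap G A)"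
    and naturality: "f \<in> hom C A B \<Longrightarrow> amap G f \<cdot>\<^bsub>D\<^esub> \<alpha> A = \<alpha> B \<cdot>\<^bsub>D\<^esub> amap F f"

locale cat_monad =
  unit: natural_transformation C C id_functor T \<eta> +
  mult: natural_transformation C C "T \<circ>\<^sub>F T" T \<mu>
  for C :: "('o, 'm) cat" (structure) and T :: "('o, 'm, 'o, 'm) functor_data"
    and \<eta> \<mu> :: "'o \<Rightarrow> 'm" +
  assumes mult_unit_left: "A \<in> Obj C \<Longrightarrow> \<mu> A \<cdot> \<eta> (omap T A) = Id C (omap T A)"
    and mult_unit_right: "A \<in> Obj C \<Longrightarrow> \<mu> A \<cdot> amap T (\<eta> A) = Id C (omap T A)"
    and mult_assoc: "A \<in> Obj C \<Longrightarrow> \<mu> A \<cdot> \<mu> (omap T A) = \<mu> A \<cdot> amap T (\<mu> A)"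

text \<open>The square with corner \<open>P\<close>, legs \<open>f : P \<rightarrow> X\<close> and \<open>g : P \<rightarrow> Y\<close>, and cospan
  \<open>m : X \<rightarrow> Z\<close>, \<open>n : Y \<rightarrow> Z\<close>.\<close>

definition weak_pullback ::
  "('o, 'm) cat \<Rightarrow> 'o \<Rightarrow> 'o \<Rightarrow> 'o \<Rightarrow> 'o \<Rightarrow> 'm \<Rightarrow> 'm \<Rightarrow> 'm \<Rightarrow> 'm \<Rightarrow> bool" where
  "weak_pullback C P X Y Z f g m n \<longleftrightarrow>
     f \<in> hom C P X \<and> g \<in> hom C P Y \<and> m \<in> hom C X Z \<and> n \<in> hom C Y Z \<and>
     m \<cdot>\<^bsub>C\<^esub> f = n \<cdot>\<^bsub>C\<^esub> g \<and>
     (\<forall>S \<in> Obj C. \<forall>b \<in> hom C S X. \<forall>c \<in> hom C S Y. m \<cdot>\<^bsub>C\<^esub> b = n \<cdot>\<^bsub>C\<^esub> c \<longrightarrow>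
       (\<exists>a \<in> hom C S P. f \<cdot>\<^bsub>C\<^esub> a = b \<and> g \<cdot>\<^bsub>C\<^esub> a = c))"

definition preserves_weak_pullbacks ::
  "('o, 'm) cat \<Rightarrow> ('p, 'n) cat \<Rightarrow> ('o, 'm, 'p, 'n) functor_data \<Rightarrow> bool" where
  "preserves_weak_pullbacks C D F \<longleftrightarrow>
     (\<forall>P X Y Z f g m n. weak_pullback C P X Y Z f g m n \<longrightarrow>
       weak_pullback D (omap F P) (omap F X) (omap F Y) (omap F Z)
         (amap F f) (amap F g) (amap F m) (amap F n))"

definition naturality_squares_weak_pullbacks ::
  "('o, 'm) cat \<Rightarrow> ('p, 'n) cat \<Rightarrow> ('o, 'm, 'p, 'n) functor_data \<Rightarrow> ('o, 'm, 'p, 'n) functor_data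
    \<Rightarrow> ('o \<Rightarrow> 'n) \<Rightarrow> bool" where
  "naturality_squares_weak_pullbacks C D F G \<alpha> \<longleftrightarrow>
     (\<forall>A B. \<forall>f \<in> hom C A B.
       weak_pullback D (omap F A) (omap G A) (omap F B) (omap G B)
         (\<alpha> A) (amap F f) (amap G f) (\<alpha> B))"

locale weakly_cartesian_monad = cat_monad +
  assumes preserves: "preserves_weak_pullbacks C C T"
    and unit_squares: "naturality_squares_weak_pullbacks C C id_functor T \<eta>"
    and mult_squares: "naturality_squares_weak_pullbacks C C (T \<circ>\<^sub>F T) T \<mu>"

locale monad_algebra = cat_monad C T \<eta> \<mu>
  for C :: "('o, 'm) cat" (structure) and T \<eta> \<mu> +
  fixes A :: 'o and e :: 'm
  assumes carrier_in_Obj: "A \<in> Obj C"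
    and structure_in_hom: "e \<in> hom C (omap T A) A"
    and structure_unit: "e \<cdot> \<eta> A = Id C A"
    and structure_mult: "e \<cdot> amap T e = e \<cdot> \<mu> A"

definition partial_evaluation ::
  "('o, 'm) cat \<Rightarrow> ('o, 'm, 'o, 'm) functor_data \<Rightarrow> ('o \<Rightarrow> 'm) \<Rightarrow> 'o \<Rightarrow> 'm \<Rightarrow> 'o
    \<Rightarrow> 'm \<Rightarrow> 'm \<Rightarrow> 'm \<Rightarrow> bool" where
  "partial_evaluation C T \<mu> A e S p q k \<longleftrightarrow>
     p \<in> hom C S (omap T A) \<and> q \<in> hom C S (omap T A) \<and>
     k \<in> hom C S (omap T (omap T A)) \<and>
     \<mu> A \<cdot>\<^bsub>C\<^esub> k = p \<and> amap T e \<cdot>\<^bsub>C\<^esub> k = q"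

definition partial_evaluation_rel ::
  "('o, 'm) cat \<Rightarrow> ('o, 'm, 'o, 'm) functor_data \<Rightarrow> ('o \<Rightarrow> 'm) \<Rightarrow> 'o \<Rightarrow> 'm \<Rightarrow> 'o \<Rightarrow> 'm rel" where
  "partial_evaluation_rel C T \<mu> A e S = {(p, q). \<exists>k. partial_evaluation C T \<mu> A e S p q k}"

end

theory Submission imports Defs begin

text \<open>Elements of \<open>TA\<close> are formal expressions, and a partial evaluation \<open>k\<close> of \<open>p\<close> into \<open>q\<close>
  is an expression of expressions that flattens to \<open>p\<close> (by \<open>\<mu>\<close>) and becomes \<open>q\<close> when its inner
  expressions are evaluated (by \<open>Te\<close>). Partial evaluations \<open>k\<close> of \<open>p\<close> into \<open>q\<close> and \<open>l\<close> of \<open>q\<close>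
  into \<open>r\<close> satisfy \<open>Te \<cdot> k = q = \<mu>\<^sub>A \<cdot> l\<close>, so they form a cone over the cospan of the naturality
  square of \<open>\<mu>\<close> at \<open>e\<close>. That square is a weak pullback, so there is a three-level expression
  \<open>a : S \<rightarrow> TTTA\<close> with \<open>\<mu>\<^sub>T\<^sub>A \<cdot> a = k\<close> and \<open>TTe \<cdot> a = l\<close>
  (lemma \<open>partial_evaluations_fill\<close>). Flattening its inner two levels, by \<open>T\<mu>\<^sub>A\<close>, then gives
  a partial evaluation of \<open>p\<close> into \<open>r\<close> (lemma \<open>partial_evaluation_inner_flattening\<close>). In the
  simplicial language of the bar construction, \<open>a\<close> is a 2-simplex filling the inner horn
  \<open>(k, l)\<close>, and \<open>T\<mu>\<^sub>A \<cdot> a\<close> is its remaining face.\<close>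

text \<open>Both endpoint equations come from comparing \<open>T\<mu>\<close> with another face map: associativity
  of \<open>\<mu>\<close> shows that the order of flattening does not affect the total expression, and
  \<open>T\<close> applied to the multiplication law of the algebra shows that evaluating the flattened inner
  expression is the same as evaluating it in two stages.\<close>

lemma (in monad_algebra) partial_evaluation_inner_flattening:
  assumes a: "a \<in> hom C S (omap T (omap T (omap T A)))"
  shows "partial_evaluation C T \<mu> A e S
    (\<mu> A \<cdot> (\<mu> (omap T A) \<cdot> a)) (amap T e \<cdot> (amap T (amap T e) \<cdot> a)) (amap T (\<mu> A) \<cdot> a)"
proof -
  let ?TA = "omap T A" and ?TTA = "omap T (omap T A)" and ?TTTA = "omap T (omap T (omap T A))"
  have mult_in_hom: "\<mu> B \<in> hom C (omap T (omap T B)) (omap T B)" if "B \<in> Obj C" for B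
    using mult.component_in_hom[OF that] by (simp add: comp_functor_def)
  have \<mu>A: "\<mu> A \<in> hom C ?TTA ?TA"
    by (rule mult_in_hom[OF carrier_in_Obj])
  have \<mu>TA: "\<mu> ?TA \<in> hom C ?TTTA ?TTA"
    by (rule mult_in_hom[OF unit.cod.omap_in_Obj[OF carrier_in_Obj]])
  have Te: "amap T e \<in> hom C ?TTA ?TA"
    by (rule unit.cod.amap_in_hom[OF structure_in_hom])
  have TTe: "amap T (amap T e) \<in> hom C ?TTTA ?TTA"
    by (rule unit.cod.amap_in_hom[OF Te])
  have T\<mu>: "amap T (\<mu> A) \<in> hom C ?TTTA ?TTA"
    by (rule unit.cod.amap_in_hom[OF \<mu>A])
  note comp = unit.dom.source.Comp_in_hom and assoc = unit.dom.source.Comp_assoc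
  have "\<mu> A \<cdot> (amap T (\<mu> A) \<cdot> a) = (\<mu> A \<cdot> \<mu> ?TA) \<cdot> a"
    using assoc[OF a T\<mu> \<mu>A] mult_assoc[OF carrier_in_Obj] by simp
  also have "\<dots> = \<mu> A \<cdot> (\<mu> ?TA \<cdot> a)"
    by (rule assoc[OF a \<mu>TA \<mu>A])
  finally have flatten: "\<mu> A \<cdot> (amap T (\<mu> A) \<cdot> a) = \<mu> A \<cdot> (\<mu> ?TA \<cdot> a)" .
  have "amap T e \<cdot> (amap T (\<mu> A) \<cdot> a) = amap T (e \<cdot> \<mu> A) \<cdot> a"
    using assoc[OF a T\<mu> Te] unit.cod.amap_Comp[OF \<mu>A structure_in_hom] by simp
  also have "\<dots> = (amap T e \<cdot> amap T (amap T e)) \<cdot> a"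
    using unit.cod.amap_Comp[OF Te structure_in_hom] by (simp add: structure_mult)
  also have "\<dots> = amap T e \<cdot> (amap T (amap T e) \<cdot> a)"
    by (rule assoc[OF a TTe Te])
  finally have evaluate: "amap T e \<cdot> (amap T (\<mu> A) \<cdot> a) = amap T e \<cdot> (amap T (amap T e) \<cdot> a)" .
  show ?thesis
    unfolding partial_evaluation_def
    using comp[OF comp[OF a \<mu>TA] \<mu>A] comp[OF comp[OF a TTe] Te] comp[OF a T\<mu>] flatten evaluate
    by blast
qed

text \<open>This is where weak cartesianness enters: the two expressions agree on the middle term \<open>q\<close>,
  and the naturality square of \<open>\<mu>\<close> at \<open>e\<close> says exactly that such a pair lifts to one nested
  expression.\<close>

lemma (in weakly_cartesian_monad) partial_evaluations_fill:
  assumes e: "e \<in> hom C (omap T A) A" and S: "S \<in> Obj C"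
    and k: "partial_evaluation C T \<mu> A e S p q k" and l: "partial_evaluation C T \<mu> A e S q r l"
  obtains a where "a \<in> hom C S (omap T (omap T (omap T A)))"
    and "\<mu> (omap T A) \<cdot> a = k" and "amap T (amap T e) \<cdot> a = l"
proof -
  have "weak_pullback C (omap T (omap T (omap T A))) (omap T (omap T A)) (omap T (omap T A))
      (omap T A) (\<mu> (omap T A)) (amap T (amap T e)) (amap T e) (\<mu> A)"
    using mult_squares e by (simp add: naturality_squares_weak_pullbacks_def comp_functor_def)
  moreover have "k \<in> hom C S (omap T (omap T A))" "l \<in> hom C S (omap T (omap T A))"
    "amap T e \<cdot> k = \<mu> A \<cdot> l"
    using k l by (simp_all add: partial_evaluation_def)
  ultimately show thesis
    using S that unfolding weak_pullback_def by blast
qed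

theorem corollary2p13:
  fixes C :: "('o, 'm) cat" and T :: "('o, 'm, 'o, 'm) functor_data"
    and \<eta> \<mu> :: "'o \<Rightarrow> 'm" and A S :: 'o and e :: 'm
  assumes "weakly_cartesian_monad C T \<eta> \<mu>"
    and "monad_algebra C T \<eta> \<mu> A e"
    and "S \<in> Obj C"
  shows "trans (partial_evaluation_rel C T \<mu> A e S)"
proof (rule transI)
  interpret weakly_cartesian_monad C T \<eta> \<mu> by fact
  interpret monad_algebra C T \<eta> \<mu> A e by fact
  fix p q r
  assume "(p, q) \<in> partial_evaluation_rel C T \<mu> A e S"
    and "(q, r) \<in> partial_evaluation_rel C T \<mu> A e S"
  then obtain k l where k: "partial_evaluation C T \<mu> A e S p q k"
    and l: "partial_evaluation C T \<mu> A e S q r l"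
    by (auto simp: partial_evaluation_rel_def)
  obtain a where a: "a \<in> hom C S (omap T (omap T (omap T A)))"
    and "\<mu> (omap T A) \<cdot>\<^bsub>C\<^esub> a = k" and "amap T (amap T e) \<cdot>\<^bsub>C\<^esub> a = l"
    using partial_evaluations_fill[OF structure_in_hom assms(3) k l] .
  moreover have "\<mu> A \<cdot>\<^bsub>C\<^esub> k = p" and "amap T e \<cdot>\<^bsub>C\<^esub> l = r"
    using k l by (simp_all add: partial_evaluation_def)
  ultimately have "partial_evaluation C T \<mu> A e S p r (amap T (\<mu> A) \<cdot>\<^bsub>C\<^esub> a)"
    using partial_evaluation_inner_flattening[OF a] by simp
  then show "(p, r) \<in> partial_evaluation_rel C T \<mu> A e S"
    by (auto simp: partial_evaluation_rel_def)
qed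

end
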